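(* Let $n>1$. In any Steiner triple system $\mathrm{STS}(n)$ of order $n$ there exists a spreading set $U$ of size $|U|\le \log_2(n+1)$. Moreover, this bound is best possible for infinitely many values of $n$: for infinitely many $n$ there is a Steiner triple system of order $n$ in which every spreading set has size at least $\log_2(n+1)$.
   Context: A Steiner triple system $\mathrm{STS}(n)$ of order $n$ is a set $V$ of $n$ points together with a family $\mathcal{F}$ of $3$-element subsets (triples) of $V$ such that every pair of distinct points of $V$ is contained in exactly one triple. For $V'\subseteq V$, the set of neighbours $N(V')$ consists of all $z\in V\setminus V'$ for which there exist distinct $x,y\in V'$ with $\{x,y,z\}\in\mathcal{F}$. The closure $\mathrm{cl}(V')$ is the smallest set $W\supseteq V'$ with $N(W)=\emptyset$ (it exists and is unique). A set $V'\subseteq V$ is spreading if $\mathrm{cl}(V')=V$. *)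

theory Defs
  imports Complex_Main
begin

definition steiner_triple_system :: "'a set \<Rightarrow> 'a set set \<Rightarrow> nat \<Rightarrow> bool" where
  "steiner_triple_system V F n \<longleftrightarrow>
     finite V \<and> card V = n \<and>
     (\<forall>T\<in>F. T \<subseteq> V \<and> card T = 3) \<and>
     (\<forall>x\<in>V. \<forall>y\<in>V. x \<noteq> y \<longrightarrow> (\<exists>!T. T \<in> F \<and> {x, y} \<subseteq> T))"

definition nbrs :: "'a set \<Rightarrow> 'a set set \<Rightarrow> 'a set \<Rightarrow> 'a set" where
  "nbrs V F A = {z \<in> V - A. \<exists>x\<in>A. \<exists>y\<in>A. x \<noteq> y \<and> {x, y, z} \<in> F}"

text \<open>The order on sets is inclusion, so \<open>LEAST\<close> picks the smallest set. It is only
  meaningful for \<open>A \<subseteq> V\<close>; existence is the lemma \<open>sts_cl_least\<close> below.\<close>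
definition sts_cl :: "'a set \<Rightarrow> 'a set set \<Rightarrow> 'a set \<Rightarrow> 'a set" where
  "sts_cl V F A = (LEAST W. A \<subseteq> W \<and> W \<subseteq> V \<and> nbrs V F W = {})"

definition spreading :: "'a set \<Rightarrow> 'a set set \<Rightarrow> 'a set \<Rightarrow> bool" where
  "spreading V F A \<longleftrightarrow> A \<subseteq> V \<and> sts_cl V F A = V"

lemma nbrs_Inter_empty:
  assumes "\<And>W. W \<in> S \<Longrightarrow> nbrs V F W = {}"
  shows "nbrs V F (\<Inter>S) = {}"
proof -
  have "z \<notin> nbrs V F (\<Inter>S)" for z
  proof
    assume "z \<in> nbrs V F (\<Inter>S)"
    then have z: "z \<in> V" "z \<notin> \<Inter>S"
      and ex: "\<exists>x\<in>\<Inter>S. \<exists>y\<in>\<Inter>S. x \<noteq> y \<and> {x, y, z} \<in> F"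
      unfolding nbrs_def mem_Collect_eq Diff_iff by iprover+
    from ex obtain x y where xy: "x \<in> \<Inter>S" "y \<in> \<Inter>S" "x \<noteq> y" "{x, y, z} \<in> F"
      by (elim bexE conjE)
    from z(2) obtain W where W: "W \<in> S" "z \<notin> W"
      unfolding Inter_iff by metis
    from W(1) xy(1,2) have "x \<in> W" "y \<in> W" by (simp_all only: Inter_iff)
    then have "z \<in> nbrs V F W"
      using W(2) z(1) xy(3,4) unfolding nbrs_def mem_Collect_eq Diff_iff by (intro conjI bexI)
    then show False using assms[OF W(1)] by simp
  qed
  then show ?thesis unfolding set_eq_iff empty_iff by iprover
qed

lemma sts_cl_eq_Inter:
  assumes "A \<subseteq> V"
  shows "sts_cl V F A = \<Inter>{W. A \<subseteq> W \<and> W \<subseteq> V \<and> nbrs V F W = {}}"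
    (is "_ = \<Inter>?S")
  unfolding sts_cl_def
proof (rule Least_equality)
  have "nbrs V F V = {}" by (simp add: nbrs_def)
  with assms have "V \<in> ?S" by simp
  then have 1: "\<Inter>?S \<subseteq> V" by (rule Inter_lower)
  have 2: "A \<subseteq> \<Inter>?S" by (rule Inter_greatest) simp
  have 3: "nbrs V F (\<Inter>?S) = {}" by (rule nbrs_Inter_empty) simp
  from 1 2 3 show "A \<subseteq> \<Inter>?S \<and> \<Inter>?S \<subseteq> V \<and> nbrs V F (\<Inter>?S) = {}" by (intro conjI)
next
  fix W assume "A \<subseteq> W \<and> W \<subseteq> V \<and> nbrs V F W = {}"
  then have "W \<in> ?S" by simp
  then show "\<Inter>?S \<le> W" by (rule Inter_lower)
qed

lemma sts_cl_least:
  assumes "A \<subseteq> V"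
  shows "A \<subseteq> sts_cl V F A" "sts_cl V F A \<subseteq> V" "nbrs V F (sts_cl V F A) = {}"
    and "\<And>W. A \<subseteq> W \<Longrightarrow> W \<subseteq> V \<Longrightarrow> nbrs V F W = {} \<Longrightarrow> sts_cl V F A \<subseteq> W"
proof -
  let ?S = "{W. A \<subseteq> W \<and> W \<subseteq> V \<and> nbrs V F W = {}}"
  note eq = sts_cl_eq_Inter[OF assms, of F]
  show "A \<subseteq> sts_cl V F A" unfolding eq by (rule Inter_greatest) simp
  have "nbrs V F V = {}" by (simp add: nbrs_def)
  with assms have "V \<in> ?S" by simp
  then show "sts_cl V F A \<subseteq> V" unfolding eq by (rule Inter_lower)
  show "nbrs V F (sts_cl V F A) = {}" unfolding eq by (rule nbrs_Inter_empty) simp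
  fix W assume "A \<subseteq> W" "W \<subseteq> V" "nbrs V F W = {}"
  then have "W \<in> ?S" by simp
  then show "sts_cl V F A \<subseteq> W" unfolding eq by (rule Inter_lower)
qed

end

(* Upper bound: adjoining a point x to a proper closed set W of size w adds x and the third points
   of the w triples through x and a point of W, so the closed size plus one at least doubles.
   Sharpness: on the nonzero binary vectors of length k, with the triples {x, y, x + y}, the
   closure of a set lies in its linear span, so a spreading set has at least k elements. *)
theory Submission
  imports Defs
begin

section \<open>Growth of closed sets\<close>

lemma third_point:
  assumes "steiner_triple_system V F n" "x \<in> V" "y \<in> V" "x \<noteq> y"
  obtains z where "z \<in> V" "z \<noteq> x" "z \<noteq> y" "{x, y, z} \<in> F"
proof -
  have "\<exists>!T. T \<in> F \<and> {x, y} \<subseteq> T"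
    using assms by (simp add: steiner_triple_system_def)
  then obtain T where T: "T \<in> F" "{x, y} \<subseteq> T" by (elim ex1E conjE)
  with assms(1) have TV: "T \<subseteq> V" and T3: "card T = 3"
    by (simp_all add: steiner_triple_system_def)
  have "finite T" using T3 by (simp add: card_ge_0_finite)
  then have "card (T - {x, y}) = 1"
    using T3 T(2) assms(4) by (simp add: card_Diff_subset)
  then obtain z where z: "T - {x, y} = {z}" by (auto simp: card_1_singleton_iff)
  with T(2) have "T = {x, y, z}" "z \<noteq> x" "z \<noteq> y" by auto
  with T(1) TV that show thesis by blast
qed

lemma closed_third_point_mem:
  assumes "nbrs V F W = {}" "{x, y, z} \<in> F" "x \<in> W" "y \<in> W" "x \<noteq> y" "z \<in> V"
  shows "z \<in> W"
  using assms unfolding nbrs_def by blast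

lemma triple_eq:
  assumes "steiner_triple_system V F n" "S \<in> F" "T \<in> F"
    and "{x, y} \<subseteq> S" "{x, y} \<subseteq> T" "x \<noteq> y"
  shows "S = T"
proof -
  have "S \<subseteq> V" using assms(1,2) by (simp add: steiner_triple_system_def)
  with assms(4) have "x \<in> V" "y \<in> V" by auto
  with assms(1,6) have "\<exists>!T. T \<in> F \<and> {x, y} \<subseteq> T"
    by (simp add: steiner_triple_system_def)
  with assms(2-5) show ?thesis by (elim ex1E) metis
qed

text \<open>The points \<open>w\<close> of \<open>W\<close>, their third points \<open>t w\<close>
  on the triples through \<open>x\<close>, and \<open>x\<close> itself all lie in the closed set
  \<open>W'\<close>. No \<open>t w\<close> is in \<open>W\<close>, since closedness would then put
  \<open>x\<close> in \<open>W\<close>.\<close>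

lemma card_closed_extension:
  assumes sts: "steiner_triple_system V F n"
    and W: "W \<subseteq> V" "nbrs V F W = {}"
    and W': "W' \<subseteq> V" "nbrs V F W' = {}" "W \<subseteq> W'"
    and x: "x \<in> W'" "x \<notin> W"
  shows "2 * card W + 1 \<le> card W'"
proof -
  have xV: "x \<in> V" using x W' by auto
  have finV: "finite V" using sts by (simp add: steiner_triple_system_def)
  have finW: "finite W" using finV W(1) by (rule rev_finite_subset)
  have "\<exists>z. z \<in> V \<and> z \<noteq> w \<and> z \<noteq> x \<and> {w, x, z} \<in> F" if "w \<in> W" for w
  proof -
    have "w \<in> V" "w \<noteq> x" using that W(1) x(2) by auto
    with third_point[OF sts _ xV, of w] show ?thesis by metis
  qed
  then obtain t where t: "\<And>w. w \<in> W \<Longrightarrow> t w \<in> V \<and> t w \<noteq> w \<and> t w \<noteq> x \<and> {w, x, t w} \<in> F"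
    by metis
  have t_mem: "t w \<in> W'" if "w \<in> W" for w
  proof (rule closed_third_point_mem[OF W'(2)])
    show "{w, x, t w} \<in> F" "t w \<in> V" using t[OF that] by simp_all
    show "w \<in> W'" "x \<in> W'" "w \<noteq> x" using that W'(3) x by auto
  qed
  have t_notin: "t w \<notin> W" if w: "w \<in> W" for w
  proof
    assume tw: "t w \<in> W"
    have "{w, t w, x} \<in> F" using t[OF w] by (simp add: insert_commute)
    moreover have "w \<noteq> t w" using t[OF w] by metis
    ultimately show False
      using closed_third_point_mem[OF W(2) _ w tw _ xV] x(2) by blast
  qed
  have inj: "inj_on t W"
  proof (rule inj_onI)
    fix v w assume vw: "v \<in> W" "w \<in> W" "t v = t w"
    \<comment> \<open>Both triples contain the pair \<open>x\<close>, \<open>t v\<close>, so they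
      coincide; \<open>v\<close> then has no place in the second triple except
      \<open>w\<close>.\<close>
    have "{v, x, t v} = {w, x, t w}"
      by (rule triple_eq[OF sts, of _ _ x "t v"]) (use t[OF vw(1)] t[OF vw(2)] vw(3) in auto)
    then have "v \<in> {w, x, t w}" by blast
    moreover have "v \<noteq> x" using vw(1) x(2) by metis
    moreover have "v \<noteq> t w" using t[OF vw(1)] vw(3) by metis
    ultimately show "v = w" by simp
  qed
  have "x \<notin> W \<union> t ` W" using x(2) t by auto
  moreover have "W \<inter> t ` W = {}" using t_notin by auto
  ultimately have "card (insert x (W \<union> t ` W)) = 2 * card W + 1"
    using finW inj by (simp add: card_Un_disjoint card_image)
  moreover have "insert x (W \<union> t ` W) \<subseteq> W'" using x W' t_mem by auto
  moreover have "finite W'" using finV W'(1) by (rule rev_finite_subset)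
  ultimately show ?thesis by (metis card_mono)
qed

text \<open>An extremal choice replaces the greedy iteration: among the sets \<open>U\<close> that
  satisfy the doubling bound \<open>P\<close>, take one with the largest closure. If that closure
  missed a point \<open>x\<close>, then \<open>insert x U\<close> would satisfy \<open>P\<close>
  with a strictly larger closure.\<close>

lemma exists_small_spreading:
  assumes sts: "steiner_triple_system V F n"
  obtains U where "spreading V F U" "2 ^ card U \<le> n + 1"
proof -
  have finV: "finite V" and cardV: "card V = n"
    using sts by (simp_all add: steiner_triple_system_def)
  define P where "P U \<longleftrightarrow> U \<subseteq> V \<and> 2 ^ card U \<le> card (sts_cl V F U) + 1" for U
  have "P {}" by (simp add: P_def)
  moreover have "card (sts_cl V F U) \<le> n" if "P U" for U
    using that card_mono[OF finV] sts_cl_least(2)[of U V F] cardV by (auto simp: P_def)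
  \<comment> \<open>The bound required here is strict, hence \<open>Suc n\<close> for closures of
    size at most \<open>n\<close>.\<close>
  ultimately have "\<exists>U. P U \<and> (\<forall>U'. P U' \<longrightarrow> card (sts_cl V F U') \<le> card (sts_cl V F U))"
    by (intro ex_has_greatest_nat[where b = "Suc n"]) (auto simp: less_Suc_eq_le)
  then obtain U where U: "P U"
    and max: "\<And>U'. P U' \<Longrightarrow> card (sts_cl V F U') \<le> card (sts_cl V F U)"
    by metis
  have UV: "U \<subseteq> V" using U by (simp add: P_def)
  note cl = sts_cl_least[OF UV, where F = F]
  have "sts_cl V F U = V"
  proof (rule ccontr)
    assume "sts_cl V F U \<noteq> V"
    with cl(2) obtain x where x: "x \<in> V" "x \<notin> sts_cl V F U" by blast
    have U'V: "insert x U \<subseteq> V" using x UV by simp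
    note cl' = sts_cl_least[OF U'V, where F = F]
    \<comment> \<open>The closure of \<open>insert x U\<close> is a closed set containing
      \<open>U\<close>, so minimality applies.\<close>
    have sub: "sts_cl V F U \<subseteq> sts_cl V F (insert x U)"
      using cl(4)[OF _ cl'(2,3)] cl'(1) by blast
    have grow: "2 * card (sts_cl V F U) + 1 \<le> card (sts_cl V F (insert x U))"
      using card_closed_extension[OF sts cl(2,3) cl'(2,3) sub] cl'(1) x(2) by blast
    have "x \<notin> U" using cl(1) x(2) by blast
    then have "2 ^ card (insert x U) = 2 * (2::nat) ^ card U"
      using finite_subset[OF UV finV] by simp
    also have "\<dots> \<le> 2 * (card (sts_cl V F U) + 1)" using U by (simp add: P_def)
    also have "\<dots> \<le> card (sts_cl V F (insert x U)) + 1" using grow by simp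
    finally have "P (insert x U)" using U'V by (simp add: P_def)
    from max[OF this] grow show False by simp
  qed
  with U UV cardV that show thesis by (simp add: spreading_def P_def)
qed

section \<open>Binary projective spaces\<close>

text \<open>The natural number with binary digits \<open>v\<close> encodes the vector \<open>v\<close>; bitwise exclusive or is
  vector addition.\<close>

definition pg_points :: "nat \<Rightarrow> nat set" where
  "pg_points k = {1..<2 ^ k}"

text \<open>These are the lines of the binary projective space: two-dimensional subspaces with zero
  removed.\<close>

definition pg_triples :: "nat \<Rightarrow> nat set set" where
  "pg_triples k = {{x, y, xor x y} | x y. x \<in> pg_points k \<and> y \<in> pg_points k \<and> x \<noteq> y}"

lemma xor_self_left [simp]: "xor x (xor x y) = y" for x y :: nat
  by (simp flip: xor.assoc)

lemma xor_self_right [simp]: "xor x (xor y x) = y" for x y :: nat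
  by (simp add: xor.commute[of y x])

lemma xor_eq_0_iff_nat [simp]: "xor x y = 0 \<longleftrightarrow> x = y" for x y :: nat
  by (metis xor_self_left xor_self_eq)

text \<open>Being below \<open>2 ^ k\<close> means being fixed by truncation to \<open>k\<close>
  bits, and truncation commutes with \<open>xor\<close>.\<close>

lemma xor_less_power2: "xor x y < 2 ^ k" if "x < 2 ^ k" "y < 2 ^ k" for x y :: nat
  using that by (simp flip: take_bit_nat_eq_self_iff)

lemma xor_mem_pg_points:
  assumes "x \<in> pg_points k" "y \<in> pg_points k" "x \<noteq> y"
  shows "xor x y \<in> pg_points k"
proof -
  have "xor x y \<noteq> 0" using assms(3) by simp
  with assms(1,2) xor_less_power2[of x k y] show ?thesis
    by (simp add: pg_points_def Suc_le_eq del: xor_eq_0_iff_nat)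
qed

text \<open>In characteristic two the three members of a triple sum to zero, so any two of them
  determine the third as their sum.\<close>

lemma pg_triple_eq:
  assumes "T \<in> pg_triples k" "x \<in> T" "y \<in> T" "x \<noteq> y"
  shows "T = {x, y, xor x y}"
proof -
  obtain a b where T: "T = {a, b, xor a b}" using assms(1) by (auto simp: pg_triples_def)
  have "x = a \<or> x = b \<or> x = xor a b" "y = a \<or> y = b \<or> y = xor a b"
    using assms(2,3) T by simp_all
  with assms(4) show ?thesis
    unfolding T by (elim disjE) (simp_all add: insert_commute ac_simps)
qed

lemma xor_neq_left: "xor x y \<noteq> x" if "y \<noteq> 0" for x y :: nat
  using that by (metis xor_self_left xor_self_eq)

lemma card_pg_triple:
  assumes "x \<in> pg_points k" "y \<in> pg_points k" "x \<noteq> y"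
  shows "card {x, y, xor x y} = 3"
proof -
  have "x \<noteq> 0" "y \<noteq> 0" using assms by (auto simp: pg_points_def)
  with xor_neq_left[of y x] xor_neq_left[of x y] have "xor x y \<noteq> x" "xor x y \<noteq> y"
    by (simp_all add: xor.commute)
  with assms(3) show ?thesis by simp
qed

lemma pg_steiner: "steiner_triple_system (pg_points k) (pg_triples k) (2 ^ k - 1)"
  unfolding steiner_triple_system_def
proof (intro conjI ballI impI)
  show "finite (pg_points k)" "card (pg_points k) = 2 ^ k - 1" by (simp_all add: pg_points_def)
  fix T assume "T \<in> pg_triples k"
  then obtain x y where "T = {x, y, xor x y}" "x \<in> pg_points k" "y \<in> pg_points k" "x \<noteq> y"
    by (auto simp: pg_triples_def)
  then show "T \<subseteq> pg_points k" "card T = 3"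
    using xor_mem_pg_points card_pg_triple by auto
next
  fix x y assume xy: "x \<in> pg_points k" "y \<in> pg_points k" "x \<noteq> y"
  show "\<exists>!T. T \<in> pg_triples k \<and> {x, y} \<subseteq> T"
  proof (rule ex1I)
    show "{x, y, xor x y} \<in> pg_triples k \<and> {x, y} \<subseteq> {x, y, xor x y}"
      using xy by (auto simp: pg_triples_def)
  qed (use pg_triple_eq xy(3) in blast)
qed

lemma exists_small_xor_closed:
  fixes U :: "nat set"
  assumes "finite U"
  shows "\<exists>S. finite S \<and> 0 \<in> S \<and> U \<subseteq> S \<and> (\<forall>x\<in>S. \<forall>y\<in>S. xor x y \<in> S) \<and> card S \<le> 2 ^ card U"
  using assms
proof (induction U)
  case empty
  show ?case by (rule exI[of _ "{0}"]) simp
next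
  case (insert u U)
  then obtain S where S: "finite S" "0 \<in> S" "U \<subseteq> S" "\<And>x y. x \<in> S \<Longrightarrow> y \<in> S \<Longrightarrow> xor x y \<in> S"
    "card S \<le> 2 ^ card U" by blast
  let ?S = "S \<union> xor u ` S"
  have "card ?S \<le> card S + card (xor u ` S)" by (rule card_Un_le)
  also have "\<dots> \<le> 2 ^ card (insert u U)"
    using card_image_le[OF S(1), of "xor u"] S(5) insert by simp
  finally have "card ?S \<le> 2 ^ card (insert u U)" .
  moreover have "u \<in> xor u ` S" using S(2) by force
  moreover have "xor x y \<in> ?S" if "x \<in> ?S" "y \<in> ?S" for x y
  proof -
    \<comment> \<open>Moving \<open>u\<close> to the front shows that a sum lies in \<open>S\<close>
      or in its coset; two copies of \<open>u\<close> cancel.\<close>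
    have "xor x (xor u b) = xor u (xor x b)" for x b by (rule xor.left_commute)
    moreover have "xor (xor u a) y = xor u (xor a y)" for a y by (rule xor.assoc)
    ultimately show ?thesis using that S(4) by auto
  qed
  ultimately show ?case using S(1-3) by (intro exI[of _ ?S]) auto
qed

lemma pg_spreading_card:
  assumes "spreading (pg_points k) (pg_triples k) U"
  shows "k \<le> card U"
proof -
  have UV: "U \<subseteq> pg_points k" and cl: "sts_cl (pg_points k) (pg_triples k) U = pg_points k"
    using assms by (simp_all add: spreading_def)
  have "finite U" using UV by (rule finite_subset) (simp add: pg_points_def)
  from exists_small_xor_closed[OF this]
  obtain S where S: "finite S" "0 \<in> S" "U \<subseteq> S" "\<And>x y. x \<in> S \<Longrightarrow> y \<in> S \<Longrightarrow> xor x y \<in> S"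
    "card S \<le> 2 ^ card U"
    by metis
  \<comment> \<open>The nonzero part of the span is closed because the third point of a triple is
    the sum of the other two. It therefore contains the closure of \<open>U\<close>, which is the
    whole space.\<close>
  have "nbrs (pg_points k) (pg_triples k) (S \<inter> pg_points k) = {}"
  proof -
    have "z \<in> S" if "{x, y, z} \<in> pg_triples k" "x \<in> S" "y \<in> S" "x \<noteq> y" for x y z
    proof -
      have "{x, y, z} = {x, y, xor x y}" using that by (intro pg_triple_eq) auto
      then have "z \<in> {x, y, xor x y}" by blast
      with that S(4) show ?thesis by blast
    qed
    then show ?thesis unfolding nbrs_def by blast
  qed
  then have "pg_points k \<subseteq> S"
    using sts_cl_least(4)[OF UV, of "S \<inter> pg_points k" "pg_triples k"] S(3) UV cl by blast
  \<comment> \<open>Putting zero back makes the count exactly \<open>2 ^ k\<close>, which can be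
    compared with \<open>2 ^ card U\<close>.\<close>
  with S(2) have "insert 0 (pg_points k) \<subseteq> S" by simp
  then have "card (insert 0 (pg_points k)) \<le> card S" by (rule card_mono[OF S(1)])
  also have "insert 0 (pg_points k) = {..<2 ^ k}" by (auto simp: pg_points_def)
  finally have "2 ^ k \<le> card S" by simp
  also note S(5)
  finally have "(2::nat) ^ k \<le> 2 ^ card U" .
  then show ?thesis by simp
qed

theorem theorem1p3:
  shows "(\<forall>(n::nat) (V::'a set) F. n > 1 \<and> steiner_triple_system V F n \<longrightarrow>
            (\<exists>U. spreading V F U \<and> real (card U) \<le> log 2 (real n + 1))) \<and>
         infinite {n::nat. n > 1 \<and>
            (\<exists>(V::nat set) F. steiner_triple_system V F n \<and>
               (\<forall>U. spreading V F U \<longrightarrow> log 2 (real n + 1) \<le> real (card U)))}"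
    (is "?upper \<and> infinite ?N")
proof
  show ?upper
  proof (intro allI impI)
    fix n :: nat and V :: "'a set" and F
    assume "n > 1 \<and> steiner_triple_system V F n"
    then obtain U where U: "spreading V F U" "2 ^ card U \<le> n + 1"
      using exists_small_spreading by blast
    have "2 ^ card U \<le> real n + 1" using of_nat_mono[OF U(2), where 'a = real] by simp
    then have "real (card U) \<le> log 2 (real n + 1)" by (simp add: le_log_iff powr_realpow)
    with U(1) show "\<exists>U. spreading V F U \<and> real (card U) \<le> log 2 (real n + 1)" by blast
  qed
  \<comment> \<open>The orders \<open>2 ^ k - 1\<close> witness sharpness, as the logarithm then
    equals \<open>k\<close>; \<open>k \<ge> 2\<close> ensures that the order exceeds 1.\<close>
  have "2 ^ k - 1 \<in> ?N" if "k \<ge> 2" for k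
  proof -
    have "(2::nat) ^ 2 \<le> 2 ^ k" using that by (rule power_increasing) simp
    then have "1 < (2::nat) ^ k - 1" by simp
    moreover have "log 2 (real (2 ^ k - 1) + 1) = k" by (simp add: of_nat_diff log_nat_power)
    ultimately show ?thesis using pg_steiner[of k] pg_spreading_card[of k] by auto
  qed
  then have "(\<lambda>k. 2 ^ k - 1) ` {2..} \<subseteq> ?N" by auto
  moreover have "inj (\<lambda>k. 2 ^ k - 1 :: nat)"
  proof (rule injI)
    fix i j :: nat assume "2 ^ i - 1 = (2 ^ j - 1 :: nat)"
    \<comment> \<open>Subtraction on \<open>nat\<close> truncates, so cancelling the 1 uses that
      both powers are at least 1.\<close>
    then have "(2::nat) ^ i = 2 ^ j"
      using one_le_power[of "2::nat" i] one_le_power[of "2::nat" j] by linarith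
    then show "i = j" by simp
  qed
  then have "infinite ((\<lambda>k. 2 ^ k - 1 :: nat) ` {2..})"
    using finite_imageD[OF _ inj_on_subset] infinite_Ici by blast
  ultimately show "infinite ?N" by (rule infinite_super)
qed

end
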